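(* Let $r_1,r_2,\rho_1,\rho_2$ be real numbers with $g:=\rho_1+\rho_2-r_1-r_2\notin\{-1,-2,\dots\}$ and such that none of $\rho_1+\rho_2+1$, $\rho_2-r_1+\frac12$, $\rho_2-r_2+\frac12$ is a nonpositive integer. Let $P_n$ be the monic polynomial eigenfunctions (Bannai-Ito polynomials) of the Dunkl shift operator $L$ defined in the context, and let $C_0=0$, $$C_n=\begin{cases}-\dfrac{n(n-2r_1-2r_2)}{4(n+g)},& n\text{ even},\ n\geq2,\\[6pt] -\dfrac{(n-2r_2+2\rho_2)(n-2r_1+2\rho_2)}{4(n+g)},& n\text{ odd}.\end{cases}$$ Then for all $n\ge0$ $$P_n(x)=W_n(x)-C_nW_{n-1}(x),$$ where $W_{-1}=0$, $W_{2m}(x)=U_m(x^2)$, $W_{2m+1}(x)=(x-\rho_2)V_m(x^2)$ and $U_m,V_m$ are the monic Wilson polynomials $$U_m(x^2)=\frac{(1+\rho_1+\rho_2)_m(\rho_2-r_1+\frac12)_m(\rho_2-r_2+\frac12)_m}{(m+g+1)_m}\,{}_4F_3\!\left({-m,\ m+g+1,\ \rho_2+x,\ \rho_2-x\atop \rho_1+\rho_2+1,\ \rho_2-r_1+\frac12,\ \rho_2-r_2+\frac12};1\right),$$ $$V_m(x^2)=\frac{(2+\rho_1+\rho_2)_m(\rho_2-r_1+\frac32)_m(\rho_2-r_2+\frac32)_m}{(m+g+2)_m}\,{}_4F_3\!\left({-m,\ m+g+2,\ \rho_2+1+x,\ \rho_2+1-x\atop \rho_1+\rho_2+2,\ \rho_2-r_1+\frac32,\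 \rho_2-r_2+\frac32};1\right).$$
   Context: For real parameters $r_1,r_2,\rho_1,\rho_2$ the Dunkl shift operator $L$ acts on polynomials by $$Lf(x)=\frac{(x-\rho_1)(x-\rho_2)}{2x}(f(x)-f(-x))+\frac{(x-r_1+1/2)(x-r_2+1/2)}{2x+1}(f(-x-1)-f(x)).$$ It maps polynomials to polynomials and $Lx^n=\lambda_nx^n+O(x^{n-1})$ with $\lambda_n=n/2$ for even $n$ and $\lambda_n=r_1+r_2-\rho_1-\rho_2-(n+1)/2$ for odd $n$. If $r_1+r_2-\rho_1-\rho_2\notin\{1,2,\dots\}$, the $\lambda_n$ are pairwise distinct, and $P_n$ denotes the unique monic polynomial of degree $n$ with $LP_n=\lambda_nP_n$. $(a)_m=a(a+1)\cdots(a+m-1)$, and ${}_4F_3$ is the (here terminating) generalized hypergeometric series. *)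

theory Defs
  imports "HOL-Analysis.Analysis" "HOL-Library.Nonpos_Ints"
begin

(* L as an operator on polynomials.  Both divisions are exact (shown below), so "div" is the genuine
   quotient; a pointwise definition would go wrong at x = 0 and x = -1/2, where x / 0 = 0. *)
definition dunkl_shift :: "real \<Rightarrow> real \<Rightarrow> real \<Rightarrow> real \<Rightarrow> real poly \<Rightarrow> real poly" where
  "dunkl_shift r1 r2 \<rho>1 \<rho>2 f =
     [:- \<rho>1, 1:] * [:- \<rho>2, 1:] * ((f - f \<circ>\<^sub>p [:0, - 1:]) div [:0, 2:])
   + [:- r1 + 1/2, 1:] * [:- r2 + 1/2, 1:] * ((f \<circ>\<^sub>p [:- 1, - 1:] - f) div [:1, 2:])"

lemma dunkl_shift_exact:
  fixes f :: "real poly"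
  shows "[:0, 2:] dvd f - f \<circ>\<^sub>p [:0, - 1:]" and "[:1, 2:] dvd f \<circ>\<^sub>p [:- 1, - 1:] - f"
proof -
  have "[:- 0, 1:] dvd f - f \<circ>\<^sub>p [:0, - 1:]"
    unfolding poly_eq_0_iff_dvd[symmetric] by (simp add: poly_pcompose)
  then have "smult 2 [:- 0, 1:] dvd f - f \<circ>\<^sub>p [:0, - 1:]"
    by (rule smult_dvd) simp
  then show "[:0, 2:] dvd f - f \<circ>\<^sub>p [:0, - 1:]" by simp
  have "[:- (- 1/2), 1:] dvd f \<circ>\<^sub>p [:- 1, - 1:] - f"
    unfolding poly_eq_0_iff_dvd[symmetric] by (simp add: poly_pcompose)
  then have "smult 2 [:- (- 1/2), 1:] dvd f \<circ>\<^sub>p [:- 1, - 1:] - f"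
    by (rule smult_dvd) simp
  then show "[:1, 2:] dvd f \<circ>\<^sub>p [:- 1, - 1:] - f" by simp
qed

lemma poly_dunkl_shift:
  assumes "x \<noteq> 0" "x \<noteq> - 1/2"
  shows "poly (dunkl_shift r1 r2 \<rho>1 \<rho>2 f) x =
     (x - \<rho>1) * (x - \<rho>2) / (2 * x) * (poly f x - poly f (- x))
   + (x - r1 + 1/2) * (x - r2 + 1/2) / (2 * x + 1) * (poly f (- x - 1) - poly f x)"
proof -
  have 1: "poly ((f - f \<circ>\<^sub>p [:0, - 1:]) div [:0, 2:]) x = (poly f x - poly f (- x)) / (2 * x)"
    using arg_cong[OF dvd_mult_div_cancel[OF dunkl_shift_exact(1)[of f]], of "\<lambda>p. poly p x"] assms(1)
    by (simp add: poly_pcompose field_simps)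
  have "2 * x + 1 \<noteq> 0" using assms(2) by (simp add: field_simps add_eq_0_iff)
  then have 2: "poly ((f \<circ>\<^sub>p [:- 1, - 1:] - f) div [:1, 2:]) x
      = (poly f (- x - 1) - poly f x) / (2 * x + 1)"
    using arg_cong[OF dvd_mult_div_cancel[OF dunkl_shift_exact(2)[of f]], of "\<lambda>p. poly p x"]
    by (simp add: poly_pcompose field_simps minus_diff_commute)
  have 3: "poly [:- c, 1:] x = x - c" "poly [:- c + 1/2, 1:] x = x - c + 1/2" for c :: real
    by simp_all
  show ?thesis
    unfolding dunkl_shift_def poly_add poly_mult 1 2 3 by simp
qed

definition dunkl_eigenvalue :: "real \<Rightarrow> real \<Rightarrow> real \<Rightarrow> real \<Rightarrow> nat \<Rightarrow> real" where
  "dunkl_eigenvalue r1 r2 \<rho>1 \<rho>2 n =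
     (if even n then real n / 2 else r1 + r2 - \<rho>1 - \<rho>2 - (real n + 1) / 2)"

definition bannai_ito :: "real \<Rightarrow> real \<Rightarrow> real \<Rightarrow> real \<Rightarrow> nat \<Rightarrow> real poly" where
  "bannai_ito r1 r2 \<rho>1 \<rho>2 n =
     (THE p. degree p = n \<and> lead_coeff p = 1 \<and>
        dunkl_shift r1 r2 \<rho>1 \<rho>2 p = smult (dunkl_eigenvalue r1 r2 \<rho>1 \<rho>2 n) p)"

definition bi_g :: "real \<Rightarrow> real \<Rightarrow> real \<Rightarrow> real \<Rightarrow> real" where
  "bi_g r1 r2 \<rho>1 \<rho>2 = \<rho>1 + \<rho>2 - r1 - r2"

definition bi_C :: "real \<Rightarrow> real \<Rightarrow> real \<Rightarrow> real \<Rightarrow> nat \<Rightarrow> real" where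
  "bi_C r1 r2 \<rho>1 \<rho>2 n =
     (if n = 0 then 0
      else if even n then
        - (real n * (real n - 2 * r1 - 2 * r2)) / (4 * (real n + bi_g r1 r2 \<rho>1 \<rho>2))
      else
        - ((real n - 2 * r2 + 2 * \<rho>2) * (real n - 2 * r1 + 2 * \<rho>2))
          / (4 * (real n + bi_g r1 r2 \<rho>1 \<rho>2)))"

definition hyp4F3 ::
  "real \<Rightarrow> real \<Rightarrow> real \<Rightarrow> real \<Rightarrow> real \<Rightarrow> real \<Rightarrow> real \<Rightarrow> real \<Rightarrow> real" where
  "hyp4F3 a1 a2 a3 a4 b1 b2 b3 z = eval_fps (fps_hypergeo [a1, a2, a3, a4] [b1, b2, b3] 1) z"

lemma hyp4F3_terminating:
  "hyp4F3 (- real m) a2 a3 a4 b1 b2 b3 z =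
     (\<Sum>k\<le>m. pochhammer (- real m) k * pochhammer a2 k * pochhammer a3 k * pochhammer a4 k
        / (pochhammer b1 k * pochhammer b2 k * pochhammer b3 k * fact k) * z ^ k)"
  unfolding hyp4F3_def eval_fps_def
  by (subst suminf_finite[of "{..m}"]) (auto simp: pochhammer_of_nat_eq_0_iff)

lemma pochhammer_pair_poly:
  fixes a x :: real
  shows "pochhammer (a + x) k * pochhammer (a - x) k
    = poly (\<Prod>j<k. [:(a + real j)\<^sup>2, - 1:]) (x\<^sup>2)"
  by (induction k) (simp_all add: pochhammer_Suc algebra_simps power2_eq_square)

lemma degree_lead_coeff_pochhammer_pair_poly:
  fixes a :: real
  defines "p \<equiv> \<lambda>k. \<Prod>j<k. [:(a + real j)\<^sup>2, - 1:]"
  shows "degree (p k) = k" "coeff (p k) k = (- 1) ^ k"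
proof -
  show 1: "degree (p k) = k"
    unfolding p_def by (subst degree_prod_eq_sum_degree) auto
  have "lead_coeff (p k) = (- 1) ^ k"
    unfolding p_def by (simp add: lead_coeff_prod)
  then show "coeff (p k) k = (- 1) ^ k" using 1 by simp
qed

lemma poly_eq_of_squares:
  fixes p q :: "real poly"
  assumes "\<And>x. poly p (x\<^sup>2) = poly q (x\<^sup>2)"
  shows "p = q"
proof -
  have "poly (p - q) x = 0" if "x \<in> {0..}" for x
    using assms[of "sqrt x"] that by simp
  then have "{0..} \<subseteq> {x. poly (p - q) x = 0}" by blast
  moreover have "infinite {0::real..}" by (rule infinite_Ici)
  ultimately have "p - q = 0" using poly_roots_finite[of "p - q"] finite_subset by blast
  then show ?thesis by simp
qed

lemma hyp4F3_poly_ex1: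
  "\<exists>!q. \<forall>x. poly q (x\<^sup>2) = K * hyp4F3 (- real m) c (a + x) (a - x) b1 b2 b3 1"
proof (rule ex_ex1I)
  let ?q = "\<Sum>k\<le>m. smult (K * (pochhammer (- real m) k * pochhammer c k
      / (pochhammer b1 k * pochhammer b2 k * pochhammer b3 k * fact k)))
      (\<Prod>j<k. [:(a + real j)\<^sup>2, - 1:])"
  show "\<exists>q. \<forall>x. poly q (x\<^sup>2) = K * hyp4F3 (- real m) c (a + x) (a - x) b1 b2 b3 1"
    by (rule exI[of _ ?q])
       (auto simp: hyp4F3_terminating poly_sum sum_distrib_left pochhammer_pair_poly[symmetric]
             intro!: sum.cong)
qed (metis poly_eq_of_squares)

lemma monic_hyp4F3_poly:
  fixes q :: "real poly"
  assumes q: "\<And>x. poly q (x\<^sup>2) = pochhammer u m * pochhammer v m * pochhammer w m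
      / pochhammer c m * hyp4F3 (- real m) c (a + x) (a - x) u v w 1"
    and nz: "pochhammer u m \<noteq> 0" "pochhammer v m \<noteq> 0" "pochhammer w m \<noteq> 0"
      "pochhammer c m \<noteq> 0"
  shows "degree q = m" and "lead_coeff q = 1"
proof -
  define K where "K = pochhammer u m * pochhammer v m * pochhammer w m / pochhammer c m"
  define t where "t k = K * (pochhammer (- real m) k * pochhammer c k
      / (pochhammer u k * pochhammer v k * pochhammer w k * fact k))" for k
  define p where "p k = (\<Prod>j<k. [:(a + real j)\<^sup>2, - 1:])" for k
  note p = degree_lead_coeff_pochhammer_pair_poly[of a, folded p_def]
  have eq: "q = (\<Sum>k\<le>m. smult (t k) (p k))"
    by (rule poly_eq_of_squares)
       (auto simp: q hyp4F3_terminating poly_sum sum_distrib_left t_def p_def K_def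
          pochhammer_pair_poly[symmetric] intro!: sum.cong)
  have tm: "t m * (- 1) ^ m = 1"
    using nz by (simp add: t_def K_def pochhammer_same field_simps flip: power_add mult_2)
  have c: "coeff q m = 1"
  proof -
    have "coeff q m = (\<Sum>k\<le>m. t k * coeff (p k) m)" by (simp add: eq coeff_sum)
    also have "\<dots> = (\<Sum>k\<in>{m}. t k * coeff (p k) m)"
      by (rule sum.mono_neutral_right) (auto simp: p(1) intro!: coeff_eq_0)
    also have "\<dots> = 1" using tm p(2)[of m] by simp
    finally show ?thesis .
  qed
  have "degree q \<le> m"
    unfolding eq by (rule degree_sum_le) (auto intro!: degree_smult_le[THEN order_trans] simp: p(1))
  with c show "degree q = m" by (metis le_antisym le_degree zero_neq_one)
  with c show "lead_coeff q = 1" by simp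
qed

(* U_m and V_m are the polynomials in y = x^2 given by the hypergeometric formula; existence and
   uniqueness are shown below. *)
definition wilson_U :: "real \<Rightarrow> real \<Rightarrow> real \<Rightarrow> real \<Rightarrow> nat \<Rightarrow> real poly" where
  "wilson_U r1 r2 \<rho>1 \<rho>2 m = (THE q. \<forall>x. poly q (x\<^sup>2) =
     pochhammer (1 + \<rho>1 + \<rho>2) m * pochhammer (\<rho>2 - r1 + 1/2) m * pochhammer (\<rho>2 - r2 + 1/2) m
       / pochhammer (real m + bi_g r1 r2 \<rho>1 \<rho>2 + 1) m
     * hyp4F3 (- real m) (real m + bi_g r1 r2 \<rho>1 \<rho>2 + 1) (\<rho>2 + x) (\<rho>2 - x)
         (\<rho>1 + \<rho>2 + 1) (\<rho>2 - r1 + 1/2) (\<rho>2 - r2 + 1/2) 1)"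

definition wilson_V :: "real \<Rightarrow> real \<Rightarrow> real \<Rightarrow> real \<Rightarrow> nat \<Rightarrow> real poly" where
  "wilson_V r1 r2 \<rho>1 \<rho>2 m = (THE q. \<forall>x. poly q (x\<^sup>2) =
     pochhammer (2 + \<rho>1 + \<rho>2) m * pochhammer (\<rho>2 - r1 + 3/2) m * pochhammer (\<rho>2 - r2 + 3/2) m
       / pochhammer (real m + bi_g r1 r2 \<rho>1 \<rho>2 + 2) m
     * hyp4F3 (- real m) (real m + bi_g r1 r2 \<rho>1 \<rho>2 + 2) (\<rho>2 + 1 + x) (\<rho>2 + 1 - x)
         (\<rho>1 + \<rho>2 + 2) (\<rho>2 - r1 + 3/2) (\<rho>2 - r2 + 3/2) 1)"

lemma poly_wilson_U:
  "poly (wilson_U r1 r2 \<rho>1 \<rho>2 m) (x\<^sup>2) =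
     pochhammer (1 + \<rho>1 + \<rho>2) m * pochhammer (\<rho>2 - r1 + 1/2) m * pochhammer (\<rho>2 - r2 + 1/2) m
       / pochhammer (real m + bi_g r1 r2 \<rho>1 \<rho>2 + 1) m
     * hyp4F3 (- real m) (real m + bi_g r1 r2 \<rho>1 \<rho>2 + 1) (\<rho>2 + x) (\<rho>2 - x)
         (\<rho>1 + \<rho>2 + 1) (\<rho>2 - r1 + 1/2) (\<rho>2 - r2 + 1/2) 1"
  unfolding wilson_U_def using theI'[OF hyp4F3_poly_ex1] by blast

lemma poly_wilson_V:
  "poly (wilson_V r1 r2 \<rho>1 \<rho>2 m) (x\<^sup>2) =
     pochhammer (2 + \<rho>1 + \<rho>2) m * pochhammer (\<rho>2 - r1 + 3/2) m * pochhammer (\<rho>2 - r2 + 3/2) m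
       / pochhammer (real m + bi_g r1 r2 \<rho>1 \<rho>2 + 2) m
     * hyp4F3 (- real m) (real m + bi_g r1 r2 \<rho>1 \<rho>2 + 2) (\<rho>2 + 1 + x) (\<rho>2 + 1 - x)
         (\<rho>1 + \<rho>2 + 2) (\<rho>2 - r1 + 3/2) (\<rho>2 - r2 + 3/2) 1"
  unfolding wilson_V_def using theI'[OF hyp4F3_poly_ex1] by blast

lemma pochhammer_nonzero:
  fixes a :: real
  assumes "a \<notin> \<int>\<^sub>\<le>\<^sub>0"
  shows "pochhammer (a + real k) m \<noteq> 0"
proof
  assume "pochhammer (a + real k) m = 0"
  then obtain j where "a + real k = - real j" by (auto simp: pochhammer_eq_0_iff)
  then have "a = - of_nat (k + j)" by simp
  with assms show False using nonpos_Ints_altdef by blast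
qed

lemma monic_wilson:
  assumes "bi_g r1 r2 \<rho>1 \<rho>2 \<notin> {- real k | k. k \<ge> 1}"
    and b: "\<rho>1 + \<rho>2 + 1 \<notin> \<int>\<^sub>\<le>\<^sub>0" "\<rho>2 - r1 + 1/2 \<notin> \<int>\<^sub>\<le>\<^sub>0" "\<rho>2 - r2 + 1/2 \<notin> \<int>\<^sub>\<le>\<^sub>0"
  shows "degree (wilson_U r1 r2 \<rho>1 \<rho>2 m) = m" "lead_coeff (wilson_U r1 r2 \<rho>1 \<rho>2 m) = 1"
    and "degree (wilson_V r1 r2 \<rho>1 \<rho>2 m) = m" "lead_coeff (wilson_V r1 r2 \<rho>1 \<rho>2 m) = 1"
proof -
  let ?g = "bi_g r1 r2 \<rho>1 \<rho>2"
  have c: "pochhammer (real m + ?g + real (Suc i)) m \<noteq> 0" for i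
  proof
    assume "pochhammer (real m + ?g + real (Suc i)) m = 0"
    then obtain j where "real m + ?g + real (Suc i) = - real j" by (auto simp: pochhammer_eq_0_iff)
    then have "?g = - real (m + Suc i + j)" by simp
    with assms(1) show False by (auto dest: spec[of _ "m + Suc i + j"])
  qed
  note nzU = b[THEN pochhammer_nonzero, of 0 m] and nzV = b[THEN pochhammer_nonzero, of 1 m]
  show "degree (wilson_U r1 r2 \<rho>1 \<rho>2 m) = m" "lead_coeff (wilson_U r1 r2 \<rho>1 \<rho>2 m) = 1"
    using monic_hyp4F3_poly[where u = "\<rho>1 + \<rho>2 + 1" and v = "\<rho>2 - r1 + 1/2"
        and w = "\<rho>2 - r2 + 1/2" and c = "real m + ?g + 1" and a = \<rho>2
        and m = m and q = "wilson_U r1 r2 \<rho>1 \<rho>2 m"] nzU c[of 0]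
    by (simp_all add: poly_wilson_U add_ac)
  show "degree (wilson_V r1 r2 \<rho>1 \<rho>2 m) = m" "lead_coeff (wilson_V r1 r2 \<rho>1 \<rho>2 m) = 1"
    using monic_hyp4F3_poly[where u = "\<rho>1 + \<rho>2 + 2" and v = "\<rho>2 - r1 + 3/2"
        and w = "\<rho>2 - r2 + 3/2" and c = "real m + ?g + 2" and a = "\<rho>2 + 1"
        and m = m and q = "wilson_V r1 r2 \<rho>1 \<rho>2 m"] nzV c[of 1]
    by (simp_all add: poly_wilson_V add_ac)
qed

(* indexed by int so that W_{-1} = 0 is literal *)
definition bi_W :: "real \<Rightarrow> real \<Rightarrow> real \<Rightarrow> real \<Rightarrow> int \<Rightarrow> real \<Rightarrow> real" where
  "bi_W r1 r2 \<rho>1 \<rho>2 k x =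
     (if k < 0 then 0
      else if even k then poly (wilson_U r1 r2 \<rho>1 \<rho>2 (nat (k div 2))) (x\<^sup>2)
      else (x - \<rho>2) * poly (wilson_V r1 r2 \<rho>1 \<rho>2 (nat (k div 2))) (x\<^sup>2))"

end

theory Submission
  imports Defs
begin

text \<open>
  Write \<open>a = \<rho>2\<close> and let \<open>\<chi>\<close> be the Newton basis whose successive zeros are
  \<open>a, -a-1, a+1, -a-2, a+2, ...\<close>.  The operator \<open>L\<close> is built from the reflections
  \<open>x \<mapsto> -x\<close> and \<open>x \<mapsto> -x-1\<close>, and each \<open>\<chi>\<^sub>n\<close> is adapted
  to one of them: \<open>\<chi>\<^sub>n\<close> of even index is invariant under the second one, and \<open>\<chi>\<^sub>n\<close> of odd index is
  \<open>x - a\<close> times an even function.  Therefore \<open>L\<close> is bidiagonal,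
  \<open>L \<chi>\<^sub>n = \<lambda>\<^sub>n \<chi>\<^sub>n + \<nu>\<^sub>n \<chi>\<^bsub>n-1\<^esub>\<close> (\<open>dunkl_shift_bi_basis\<close>), and
  \<open>\<Sum> c\<^sub>n \<chi>\<^sub>n\<close> is an eigenvector with eigenvalue \<open>\<mu>\<close> as soon as the two-term recurrence
  \<open>c\<^sub>n (\<mu> - \<lambda>\<^sub>n) = \<nu>\<^bsub>n+1\<^esub> c\<^bsub>n+1\<^esub>\<close> holds (\<open>dunkl_shift_eigenvectorI\<close>).

  The Wilson polynomials are expanded in the same basis.  The series of \<open>V\<^sub>m\<close>, multiplied by
  \<open>x - a\<close>, runs over the \<open>\<chi>\<^sub>n\<close> of odd index.  The series of \<open>U\<^sub>m\<close> runs over the products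
  \<open>(a+x)\<^sub>k (a-x)\<^sub>k = \<chi>\<^bsub>2k\<^esub> + k \<chi>\<^bsub>2k-1\<^esub>\<close> (\<open>pochhammer_pair_bi_basis\<close>).  If \<open>u\<^sub>k\<close> and
  \<open>v\<^sub>k\<close> are the coefficients of these series, then the coefficients of \<open>W\<^sub>n - C W\<^bsub>n-1\<^esub>\<close> at
  \<open>\<chi>\<^bsub>2k\<^esub>\<close> and \<open>\<chi>\<^bsub>2k+1\<^esub>\<close> are \<open>u\<^sub>k\<close> and \<open>(k+1) u\<^bsub>k+1\<^esub> - C v\<^sub>k\<close> for even \<open>n\<close>, and \<open>-C u\<^sub>k\<close> and
  \<open>v\<^sub>k - C (k+1) u\<^bsub>k+1\<^esub>\<close> for odd \<open>n\<close>.  Both \<open>u\<^bsub>k+1\<^esub>\<close> and \<open>v\<^sub>k\<close> are rational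
  multiples of \<open>u\<^sub>k\<close> (\<open>wilson_coeff_Suc\<close>, \<open>wilson_coeff_raise_degree\<close>,
  \<open>wilson_coeff_raise_parameters\<close>), so the recurrence becomes an identity between rational functions
  of \<open>k\<close>, and \<open>C = C\<^sub>n\<close> is the constant for which the factors combine.

  The eigenvector found in this way is \<open>P\<^sub>n\<close>, because \<open>L\<close> is triangular with respect to the
  degree and its eigenvalues are distinct when \<open>g\<close> is not a negative integer
  (\<open>bannai_ito_eqI\<close>).
\<close>

section \<open>The operator on a basis of polynomials\<close>

text \<open>The pointwise formula for \<open>L\<close> is only available away from its two apparent poles, which is
  enough to compare polynomials.\<close>

lemma poly_eqI_off_poles:
  fixes p q :: "real poly"
  assumes "\<And>x. x \<noteq> 0 \<Longrightarrow> x \<noteq> - 1/2 \<Longrightarrow> poly p x = poly q x"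
  shows "p = q"
proof (rule ccontr)
  assume "p \<noteq> q"
  then have "finite {x. poly (p - q) x = 0}" by (intro poly_roots_finite) simp
  moreover have "UNIV - {0, - 1/2} \<subseteq> {x. poly (p - q) x = 0}" using assms by auto
  ultimately have "finite (UNIV - {0, - 1/2 :: real})" by (rule rev_finite_subset)
  then show False by (simp add: infinite_UNIV_char_0)
qed

lemma dunkl_shift_add:
  "dunkl_shift r1 r2 \<rho>1 \<rho>2 (p + q) = dunkl_shift r1 r2 \<rho>1 \<rho>2 p + dunkl_shift r1 r2 \<rho>1 \<rho>2 q"
  by (rule poly_eqI_off_poles)
     (simp add: poly_dunkl_shift add_diff_add distrib_left
        del: times_divide_eq_left times_divide_eq_right times_divide_times_eq)

lemma dunkl_shift_smult:
  "dunkl_shift r1 r2 \<rho>1 \<rho>2 (smult s p) = smult s (dunkl_shift r1 r2 \<rho>1 \<rho>2 p)"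
  by (rule poly_eqI_off_poles)
     (simp add: poly_dunkl_shift distrib_left mult.left_commute flip: right_diff_distrib
        del: times_divide_eq_left times_divide_eq_right times_divide_times_eq)

lemma dunkl_shift_0: "dunkl_shift r1 r2 \<rho>1 \<rho>2 0 = 0"
  using dunkl_shift_smult[of r1 r2 \<rho>1 \<rho>2 0 0] by simp

lemma dunkl_shift_sum:
  "dunkl_shift r1 r2 \<rho>1 \<rho>2 (\<Sum>i\<in>A. f i) = (\<Sum>i\<in>A. dunkl_shift r1 r2 \<rho>1 \<rho>2 (f i))"
  by (induction A rule: infinite_finite_induct) (simp_all add: dunkl_shift_0 dunkl_shift_add)

text \<open>The factor that leads from \<open>2k\<close> to \<open>2k+1\<close> vanishes at \<open>a + k\<close>, the next one at
  \<open>-a - 1 - k\<close>.  The second factor has leading coefficient \<open>-1\<close>, so that the values are products of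
  Pochhammer symbols without signs.\<close>

fun bi_basis :: "real \<Rightarrow> nat \<Rightarrow> real poly" where
  "bi_basis a 0 = 1"
| "bi_basis a (Suc n) = (if even n then [:- (a + real (n div 2)), 1:]
     else [:- (a + 1 + real (n div 2)), - 1:]) * bi_basis a n"

lemma degree_bi_basis: "bi_basis a n \<noteq> 0 \<and> degree (bi_basis a n) = n"
  by (induction n) (auto simp: degree_mult_eq simp del: mult_pCons_left)

lemma poly_bi_basis_even:
  "poly (bi_basis a (2 * k)) x = pochhammer (a - x) k * pochhammer (a + 1 + x) k"
  by (induction k) (simp_all add: pochhammer_Suc algebra_simps del: mult_pCons_left)

text \<open>Even and odd index exhibit the two symmetries: the even one is invariant under
  \<open>x \<mapsto> -x-1\<close>, and the cofactor of \<open>x - a\<close> in the odd one is invariant under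
  \<open>x \<mapsto> -x\<close>.  The recursion gives
  \<open>-(a-x)\<^bsub>k+1\<^esub> (a+1+x)\<^sub>k\<close>, from which the first factor \<open>a-x\<close> is pulled out.\<close>

lemma poly_bi_basis_odd:
  "poly (bi_basis a (Suc (2 * k))) x = (x - a) * (pochhammer (a + 1 + x) k * pochhammer (a + 1 - x) k)"
proof -
  have "(a + real k - x) * pochhammer (a - x) k = (a - x) * pochhammer (a + 1 - x) k"
    using pochhammer_rec[of "a - x" k] pochhammer_Suc[of "a - x" k] by (simp add: algebra_simps)
  then have "- ((a + real k - x) * pochhammer (a - x) k) * pochhammer (a + 1 + x) k
      = - ((a - x) * pochhammer (a + 1 - x) k) * pochhammer (a + 1 + x) k" by simp
  moreover have "poly (bi_basis a (Suc (2 * k))) x = (x - a - real k) * poly (bi_basis a (2 * k)) x"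
    by (simp add: algebra_simps)
  ultimately show ?thesis
    unfolding poly_bi_basis_even by (simp add: algebra_simps)
qed

text \<open>The products \<open>(a+x)\<^sub>k (a-x)\<^sub>k\<close> in the series of \<open>U\<^sub>m\<close> are not basis elements themselves: both sides are
  multiples of the odd element, by \<open>-(a+x)\<close> and by \<open>-(a+1+k+x) + (k+1)\<close>.\<close>

lemma pochhammer_pair_bi_basis:
  "pochhammer (a + x) (Suc k) * pochhammer (a - x) (Suc k)
     = poly (bi_basis a (2 * Suc k)) x + real (Suc k) * poly (bi_basis a (Suc (2 * k))) x"
proof -
  have "poly (bi_basis a (2 * Suc k)) x = - (a + 1 + real k + x) * poly (bi_basis a (Suc (2 * k))) x"
    by (simp add: algebra_simps)
  moreover have "pochhammer (a + x) (Suc k) * pochhammer (a - x) (Suc k)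
      = - (a + x) * poly (bi_basis a (Suc (2 * k))) x"
    unfolding poly_bi_basis_odd by (simp add: pochhammer_rec[of "a + x"] pochhammer_rec[of "a - x"] algebra_simps)
  ultimately show ?thesis by (simp add: algebra_simps)
qed

definition dunkl_subdiag :: "real \<Rightarrow> real \<Rightarrow> real \<Rightarrow> real \<Rightarrow> nat \<Rightarrow> real" where
  "dunkl_subdiag r1 r2 \<rho>1 \<rho>2 n =
     (if even n then real (n div 2) * (\<rho>1 + \<rho>2 + real (n div 2))
      else - ((\<rho>2 - r1 + 1/2 + real (n div 2)) * (\<rho>2 - r2 + 1/2 + real (n div 2))))"

text \<open>For even \<open>n\<close> the shifted difference vanishes, and the reflected one leaves
  \<open>-k (x - \<rho>1) \<chi>\<^bsub>n-1\<^esub>\<close>.  For odd \<open>n\<close> both differences become multiples of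
  \<open>\<chi>\<^bsub>n-1\<^esub>\<close> by monic quadratics with opposite signs, whose leading terms cancel.  In either case a
  linear multiple of \<open>\<chi>\<^bsub>n-1\<^esub>\<close> is left, which is a combination of \<open>\<chi>\<^sub>n\<close> and
  \<open>\<chi>\<^bsub>n-1\<^esub>\<close>.  The case \<open>n = 0\<close> is covered because \<open>\<nu>\<^sub>0 = 0\<close>.\<close>

lemma dunkl_shift_bi_basis:
  "dunkl_shift r1 r2 \<rho>1 \<rho>2 (bi_basis \<rho>2 n) =
     smult (dunkl_eigenvalue r1 r2 \<rho>1 \<rho>2 n) (bi_basis \<rho>2 n)
   + smult (dunkl_subdiag r1 r2 \<rho>1 \<rho>2 n) (bi_basis \<rho>2 (n - 1))" (is "_ = ?R")
proof (cases "n = 0")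
  case True
  then show ?thesis
    by (intro poly_eqI_off_poles) (simp add: poly_dunkl_shift dunkl_eigenvalue_def dunkl_subdiag_def)
next
  case False
  then obtain j where "n = Suc j" by (cases n) auto
  then obtain k where "n = Suc (2 * k) \<or> n = 2 * Suc k"
    by (cases "even j") (fastforce elim!: evenE oddE)+
  then show ?thesis
  proof
    assume n: "n = Suc (2 * k)"
    show ?thesis
    proof (rule poly_eqI_off_poles)
      fix x :: real
      assume x: "x \<noteq> 0" "x \<noteq> - 1/2"
      define B where "B = poly (bi_basis \<rho>2 (2 * k)) x"
      define E where "E = pochhammer (\<rho>2 + 1 + x) k * pochhammer (\<rho>2 + 1 - x) k"
      have f: "poly (bi_basis \<rho>2 n) y = (y - \<rho>2 - real k) * poly (bi_basis \<rho>2 (2 * k)) y" for y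
        by (simp add: n algebra_simps)
      have B': "poly (bi_basis \<rho>2 (2 * k)) (- x - 1) = B"
        unfolding B_def poly_bi_basis_even by (simp add: algebra_simps)
      have d1: "(poly (bi_basis \<rho>2 n) x - poly (bi_basis \<rho>2 n) (- x)) = 2 * x * E"
        unfolding n poly_bi_basis_odd E_def by (simp add: algebra_simps)
      have "(x - \<rho>2) * E = (x - \<rho>2 - real k) * B"
        using f[of x] unfolding n poly_bi_basis_odd E_def B_def .
      then have t1: "(x - \<rho>1) * (x - \<rho>2) / (2 * x) * (poly (bi_basis \<rho>2 n) x - poly (bi_basis \<rho>2 n) (- x))
          = (x - \<rho>1) * (x - \<rho>2 - real k) * B"
        using x(1) unfolding d1 by simp
      have d2: "poly (bi_basis \<rho>2 n) (- x - 1) - poly (bi_basis \<rho>2 n) x = - ((2 * x + 1) * B)"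
        unfolding f B' B_def[symmetric] by (simp add: algebra_simps)
      have "2 * x + 1 \<noteq> 0" using x(2) by auto
      then have t2: "(x - r1 + 1/2) * (x - r2 + 1/2) / (2 * x + 1)
            * (poly (bi_basis \<rho>2 n) (- x - 1) - poly (bi_basis \<rho>2 n) x)
          = - ((x - r1 + 1/2) * (x - r2 + 1/2) * B)"
        unfolding d2 by simp
      have r: "poly ?R x = (r1 + r2 - \<rho>1 - \<rho>2 - real k - 1) * ((x - \<rho>2 - real k) * B)
        - (\<rho>2 - r1 + 1/2 + real k) * (\<rho>2 - r2 + 1/2 + real k) * B"
        unfolding poly_add poly_smult f B_def[symmetric]
        by (simp add: n dunkl_eigenvalue_def dunkl_subdiag_def B_def del: bi_basis.simps) (simp add: field_simps)
      show "poly (dunkl_shift r1 r2 \<rho>1 \<rho>2 (bi_basis \<rho>2 n)) x = poly ?R x"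
        unfolding poly_dunkl_shift[OF x] t1 t2 r by algebra
    qed
  next
    assume n: "n = 2 * Suc k"
    show ?thesis
    proof (rule poly_eqI_off_poles)
      fix x :: real
      assume x: "x \<noteq> 0" "x \<noteq> - 1/2"
      define B where "B = poly (bi_basis \<rho>2 (Suc (2 * k))) x"
      define E where "E = pochhammer (\<rho>2 + 1 + x) k * pochhammer (\<rho>2 + 1 - x) k"
      have B: "B = (x - \<rho>2) * E"
        unfolding B_def poly_bi_basis_odd E_def ..
      have f: "poly (bi_basis \<rho>2 n) y = - (y + \<rho>2 + 1 + real k) * poly (bi_basis \<rho>2 (Suc (2 * k))) y" for y
        by (simp add: n algebra_simps)
      have d1: "poly (bi_basis \<rho>2 n) x - poly (bi_basis \<rho>2 n) (- x) = - (real (Suc k) * (2 * x) * E)"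
        unfolding f poly_bi_basis_odd E_def by (simp add: algebra_simps)
      have t1: "(x - \<rho>1) * (x - \<rho>2) / (2 * x) * (poly (bi_basis \<rho>2 n) x - poly (bi_basis \<rho>2 n) (- x))
          = - (real (Suc k) * (x - \<rho>1) * B)"
        using x(1) unfolding d1 B by simp
      have d2: "poly (bi_basis \<rho>2 n) (- x - 1) - poly (bi_basis \<rho>2 n) x = 0"
        unfolding n poly_bi_basis_even by (simp add: algebra_simps)
      have r: "poly ?R x = real (Suc k) * (- (x + \<rho>2 + 1 + real k) * B)
        + real (Suc k) * (\<rho>1 + \<rho>2 + real (Suc k)) * B"
        unfolding poly_add poly_smult f B_def[symmetric]
        by (simp add: n dunkl_eigenvalue_def dunkl_subdiag_def B_def del: bi_basis.simps)
      show "poly (dunkl_shift r1 r2 \<rho>1 \<rho>2 (bi_basis \<rho>2 n)) x = poly ?R x"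
        unfolding poly_dunkl_shift[OF x] t1 d2 r by (simp add: algebra_simps)
    qed
  qed
qed

text \<open>Comparing coefficients of \<open>\<chi>\<^sub>n\<close> turns the eigenvalue equation into a two-term recurrence.  The
  bound \<open>M\<close> may exceed the degree of the sum, so that even and odd degrees can be treated alike.\<close>

lemma dunkl_shift_eigenvectorI:
  assumes rec: "\<And>n. n \<le> M \<Longrightarrow> c n * (\<mu> - dunkl_eigenvalue r1 r2 \<rho>1 \<rho>2 n)
      = dunkl_subdiag r1 r2 \<rho>1 \<rho>2 (Suc n) * c (Suc n)"
    and top: "c (Suc M) = 0"
  defines "f \<equiv> \<Sum>n\<le>M. smult (c n) (bi_basis \<rho>2 n)"
  shows "dunkl_shift r1 r2 \<rho>1 \<rho>2 f = smult \<mu> f"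
proof -
  let ?b = "bi_basis \<rho>2" and ?l = "dunkl_eigenvalue r1 r2 \<rho>1 \<rho>2"
    and ?v = "dunkl_subdiag r1 r2 \<rho>1 \<rho>2"
  have "(\<Sum>n\<le>Suc M. smult (c n * ?v n) (?b (n - 1)))
      = (\<Sum>n\<le>M. smult (c (Suc n) * ?v (Suc n)) (?b n))"
    by (subst sum.atMost_Suc_shift) (simp add: dunkl_subdiag_def)
  then have shift: "(\<Sum>n\<le>M. smult (c n * ?v n) (?b (n - 1)))
      = (\<Sum>n\<le>M. smult (c (Suc n) * ?v (Suc n)) (?b n))"
    using top by simp
  have "dunkl_shift r1 r2 \<rho>1 \<rho>2 f
      = (\<Sum>n\<le>M. smult (c n * ?l n) (?b n)) + (\<Sum>n\<le>M. smult (c n * ?v n) (?b (n - 1)))"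
    by (simp add: f_def dunkl_shift_sum dunkl_shift_smult dunkl_shift_bi_basis smult_add_right sum.distrib)
  also have "\<dots> = (\<Sum>n\<le>M. smult (c n * ?l n + c (Suc n) * ?v (Suc n)) (?b n))"
    unfolding shift by (simp add: smult_add_left sum.distrib)
  also have "\<dots> = (\<Sum>n\<le>M. smult \<mu> (smult (c n) (?b n)))"
  proof (rule sum.cong[OF refl])
    fix n assume "n \<in> {..M}"
    then have "c n * ?l n + c (Suc n) * ?v (Suc n) = \<mu> * c n"
      using rec[of n] by (simp add: algebra_simps)
    then show "smult (c n * ?l n + c (Suc n) * ?v (Suc n)) (?b n) = smult \<mu> (smult (c n) (?b n))"
      by simp
  qed
  also have "\<dots> = smult \<mu> f"
    unfolding f_def by (induction M) (simp_all add: smult_add_right)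
  finally show ?thesis .
qed

section \<open>Uniqueness of the monic eigenpolynomial\<close>

text \<open>Bidiagonality transfers from the basis to all polynomials, by splitting off the leading
  multiple of \<open>\<chi>\<^sub>n\<close>.\<close>

lemma dunkl_shift_triangular:
  assumes "degree f \<le> n"
  shows "degree (dunkl_shift r1 r2 \<rho>1 \<rho>2 f) \<le> n
    \<and> coeff (dunkl_shift r1 r2 \<rho>1 \<rho>2 f) n = dunkl_eigenvalue r1 r2 \<rho>1 \<rho>2 n * coeff f n"
  using assms
proof (induction n arbitrary: f rule: less_induct)
  case (less n)
  let ?b = "bi_basis \<rho>2" and ?l = "dunkl_eigenvalue r1 r2 \<rho>1 \<rho>2"
    and ?v = "dunkl_subdiag r1 r2 \<rho>1 \<rho>2" and ?L = "dunkl_shift r1 r2 \<rho>1 \<rho>2"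
  have deg: "degree (?b i) = i" for i using degree_bi_basis by blast
  have lc: "coeff (?b n) n \<noteq> 0" using degree_bi_basis[of \<rho>2 n] leading_coeff_0_iff by metis
  define s where "s = coeff f n / coeff (?b n) n"
  define h where "h = f - smult s (?b n)"
  have hn: "coeff h n = 0" using lc by (simp add: h_def s_def)
  have dh: "degree h \<le> n" unfolding h_def
    by (intro degree_diff_le less.prems order_trans[OF degree_smult_le]) (simp add: deg)
  have Lf: "?L f = smult (s * ?l n) (?b n) + smult (s * ?v n) (?b (n - 1)) + ?L h"
  proof -
    have "f = smult s (?b n) + h" by (simp add: h_def)
    then show ?thesis
      by (simp only: dunkl_shift_add dunkl_shift_smult dunkl_shift_bi_basis smult_add_right smult_smult)
  qed
  have low: "coeff (smult (s * ?v n) (?b (n - 1))) n = 0"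
  proof (cases n)
    case 0 then show ?thesis by (simp add: dunkl_subdiag_def)
  next
    case (Suc k) then show ?thesis by (simp add: coeff_eq_0 deg del: bi_basis.simps)
  qed
  have "degree (?L h) \<le> n \<and> coeff (?L h) n = 0"
  proof (cases "h = 0")
    case True then show ?thesis by (simp add: dunkl_shift_0)
  next
    case False
    then have "degree h \<noteq> n" using hn leading_coeff_0_iff by metis
    with dh have lt: "degree h < n" by simp
    with less.IH[OF lt, of h] show ?thesis by (simp add: coeff_eq_0)
  qed
  moreover have "degree (?L f) \<le> n"
    unfolding Lf using calculation
    by (intro degree_add_le order_trans[OF degree_smult_le]) (simp_all add: deg)
  ultimately show ?case
    using lc low by (simp add: Lf s_def)
qed

text \<open>Eigenvalues of equal parity differ visibly.  For \<open>i\<close> even and \<open>j\<close> odd, equality would mean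
  \<open>g = -(i+j+1)/2\<close>, a negative integer.\<close>

lemma dunkl_eigenvalue_inj:
  assumes "bi_g r1 r2 \<rho>1 \<rho>2 \<notin> {- real k | k. k \<ge> 1}"
    and "dunkl_eigenvalue r1 r2 \<rho>1 \<rho>2 m = dunkl_eigenvalue r1 r2 \<rho>1 \<rho>2 n"
  shows "m = n"
proof -
  have no: "2 * bi_g r1 r2 \<rho>1 \<rho>2 \<noteq> - real (i + j + 1)" if "even i" "odd j" for i j
  proof
    assume eq: "2 * bi_g r1 r2 \<rho>1 \<rho>2 = - real (i + j + 1)"
    have "even (i + j + 1)" using that by simp
    then obtain k where k: "i + j + 1 = 2 * k" by (elim evenE)
    with eq have "bi_g r1 r2 \<rho>1 \<rho>2 = - real k" "k \<ge> 1" by simp_all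
    with assms(1) show False by blast
  qed
  show ?thesis
    using assms(2) no[of m n] no[of n m]
    by (cases "even m"; cases "even n") (simp_all add: dunkl_eigenvalue_def bi_g_def field_simps)
qed

text \<open>The difference of two monic eigenpolynomials of degree \<open>n\<close> would be an eigenvector of smaller
  degree \<open>d\<close>, so by triangularity \<open>\<lambda>\<^sub>n = \<lambda>\<^sub>d\<close>.\<close>

lemma bannai_ito_eqI:
  assumes g: "bi_g r1 r2 \<rho>1 \<rho>2 \<notin> {- real k | k. k \<ge> 1}"
    and p: "degree p = n" "lead_coeff p = 1"
      "dunkl_shift r1 r2 \<rho>1 \<rho>2 p = smult (dunkl_eigenvalue r1 r2 \<rho>1 \<rho>2 n) p"
  shows "bannai_ito r1 r2 \<rho>1 \<rho>2 n = p"
  unfolding bannai_ito_def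
proof (rule the_equality)
  fix q
  assume q: "degree q = n \<and> lead_coeff q = 1 \<and>
    dunkl_shift r1 r2 \<rho>1 \<rho>2 q = smult (dunkl_eigenvalue r1 r2 \<rho>1 \<rho>2 n) q"
  define d where "d = q - p"
  have Ld: "dunkl_shift r1 r2 \<rho>1 \<rho>2 d = smult (dunkl_eigenvalue r1 r2 \<rho>1 \<rho>2 n) d"
  proof -
    have "q = d + p" by (simp add: d_def)
    with q p(3) have "dunkl_shift r1 r2 \<rho>1 \<rho>2 d + smult (dunkl_eigenvalue r1 r2 \<rho>1 \<rho>2 n) p
        = smult (dunkl_eigenvalue r1 r2 \<rho>1 \<rho>2 n) (d + p)"
      by (metis dunkl_shift_add)
    then show ?thesis by (simp add: smult_add_right)
  qed
  have "d = 0"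
  proof (rule ccontr)
    assume "d \<noteq> 0"
    then have lc: "coeff d (degree d) \<noteq> 0" by simp
    have "coeff p n = 1" "coeff q n = 1" using p(1,2) q by auto
    then have "coeff d n = 0" by (simp add: d_def)
    with lc have "degree d \<noteq> n" by auto
    moreover have "dunkl_eigenvalue r1 r2 \<rho>1 \<rho>2 n * coeff d (degree d)
        = dunkl_eigenvalue r1 r2 \<rho>1 \<rho>2 (degree d) * coeff d (degree d)"
      using dunkl_shift_triangular[of d "degree d" r1 r2 \<rho>1 \<rho>2] by (simp add: Ld)
    then have "dunkl_eigenvalue r1 r2 \<rho>1 \<rho>2 n = dunkl_eigenvalue r1 r2 \<rho>1 \<rho>2 (degree d)"
      using lc by simp
    ultimately show False using dunkl_eigenvalue_inj[OF g] by metis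
  qed
  then show "q = p" by (simp add: d_def)
qed (use p in blast)

section \<open>Coefficients of the Wilson polynomials\<close>

text \<open>The coefficient of the \<open>k\<close>-th product of shifted factors in a monic Wilson polynomial.  The normalising
  constant is included, so that the relations below need no separate bookkeeping for it.\<close>

definition wilson_coeff :: "nat \<Rightarrow> real \<Rightarrow> real \<Rightarrow> real \<Rightarrow> real \<Rightarrow> nat \<Rightarrow> real" where
  "wilson_coeff m c b1 b2 b3 k =
     pochhammer b1 m * pochhammer b2 m * pochhammer b3 m / pochhammer c m *
     (pochhammer (- real m) k * pochhammer c k
        / (pochhammer b1 k * pochhammer b2 k * pochhammer b3 k * fact k))"

lemma wilson_coeff_eq_0: "k > m \<Longrightarrow> wilson_coeff m c b1 b2 b3 k = 0"
  by (simp add: wilson_coeff_def pochhammer_of_nat_eq_0_iff)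

lemma poly_wilson_U_sum:
  "poly (wilson_U r1 r2 \<rho>1 \<rho>2 m) (x\<^sup>2) =
     (\<Sum>k\<le>m. wilson_coeff m (real m + bi_g r1 r2 \<rho>1 \<rho>2 + 1)
        (\<rho>1 + \<rho>2 + 1) (\<rho>2 - r1 + 1/2) (\<rho>2 - r2 + 1/2) k
        * (pochhammer (\<rho>2 + x) k * pochhammer (\<rho>2 - x) k))"
  unfolding poly_wilson_U hyp4F3_terminating sum_distrib_left wilson_coeff_def
  by (rule sum.cong) (simp_all add: add_ac)

lemma poly_wilson_V_sum:
  "(x - \<rho>2) * poly (wilson_V r1 r2 \<rho>1 \<rho>2 m) (x\<^sup>2) =
     (\<Sum>k\<le>m. wilson_coeff m (real m + bi_g r1 r2 \<rho>1 \<rho>2 + 2)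
        (\<rho>1 + \<rho>2 + 1 + 1) (\<rho>2 - r1 + 1/2 + 1) (\<rho>2 - r2 + 1/2 + 1) k
        * poly (bi_basis \<rho>2 (Suc (2 * k))) x)"
proof -
  have b: "\<rho>1 + \<rho>2 + 1 + 1 = \<rho>1 + \<rho>2 + 2" "\<rho>2 - r1 + 1/2 + 1 = \<rho>2 - r1 + 3/2"
    "\<rho>2 - r2 + 1/2 + 1 = \<rho>2 - r2 + 3/2" by simp_all
  show ?thesis
    unfolding poly_wilson_V hyp4F3_terminating sum_distrib_left wilson_coeff_def poly_bi_basis_odd b
    by (rule sum.cong) (simp_all add: add_ac mult_ac)
qed

context
  fixes b1 b2 b3 :: real
  assumes b: "b1 \<notin> \<int>\<^sub>\<le>\<^sub>0" "b2 \<notin> \<int>\<^sub>\<le>\<^sub>0" "b3 \<notin> \<int>\<^sub>\<le>\<^sub>0"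
begin

lemma add_nat_nonzero: "b1 + real k \<noteq> 0" "b2 + real k \<noteq> 0" "b3 + real k \<noteq> 0"
  using pochhammer_nonzero[of _ k 1] b by auto

lemma wilson_coeff_Suc:
  "real (Suc k) * ((b1 + real k) * (b2 + real k) * (b3 + real k)) * wilson_coeff m c b1 b2 b3 (Suc k)
     = (real k - real m) * (c + real k) * wilson_coeff m c b1 b2 b3 k"
proof -
  note nz = add_nat_nonzero[of k]
  have "wilson_coeff m c b1 b2 b3 (Suc k) = wilson_coeff m c b1 b2 b3 k
      * ((real k - real m) * (c + real k)
         / (real (Suc k) * ((b1 + real k) * (b2 + real k) * (b3 + real k))))"
    unfolding wilson_coeff_def pochhammer_Suc fact_Suc of_nat_mult
    by (simp add: mult_ac divide_inverse del: of_nat_Suc)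
  then show ?thesis using nz by (simp del: of_nat_Suc)
qed

text \<open>This and the next lemma relate the series of \<open>U\<close> and of \<open>V\<close>, which differ by a unit shift of
  the lower parameters.  Here the second parameter \<open>c\<close> is common and the degrees differ by one, the
  situation of \<open>W\<^sub>n\<close> and \<open>W\<^bsub>n-1\<^esub>\<close> for even \<open>n\<close>; in the next lemma the degrees
  agree and \<open>c\<close> shifts as well, as for odd \<open>n\<close>.\<close>

lemma wilson_coeff_raise_degree:
  assumes c: "pochhammer c (Suc m) \<noteq> 0"
  shows "real (Suc k) * (c + real m) * wilson_coeff (Suc m) c b1 b2 b3 (Suc k)
     = - real (Suc m) * (c + real k) * wilson_coeff m c (b1 + 1) (b2 + 1) (b3 + 1) k"
proof -
  have nz: "b1 \<noteq> 0" "b2 \<noteq> 0" "b3 \<noteq> 0" using add_nat_nonzero[of 0] by simp_all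
  have cm: "c + real m \<noteq> 0" using c by (simp add: pochhammer_Suc)
  have sm: "pochhammer (- real (Suc m)) (Suc k) = - real (Suc m) * pochhammer (- real m) k"
    by (simp add: pochhammer_rec)
  have "wilson_coeff (Suc m) c b1 b2 b3 (Suc k)
      = - real (Suc m) * (c + real k) / (real (Suc k) * (c + real m))
        * wilson_coeff m c (b1 + 1) (b2 + 1) (b3 + 1) k"
    unfolding wilson_coeff_def sm pochhammer_rec[of b1] pochhammer_rec[of b2] pochhammer_rec[of b3]
      pochhammer_Suc[of c] fact_Suc of_nat_mult
    using nz by (simp add: divide_inverse mult_ac del: of_nat_Suc) (simp add: field_simps)
  then show ?thesis using cm by (simp del: of_nat_Suc)
qed

lemma wilson_coeff_raise_parameters:
  assumes c: "pochhammer c (Suc m) \<noteq> 0"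
  shows "(c + real k) * ((b1 + real m) * (b2 + real m) * (b3 + real m)) * wilson_coeff m c b1 b2 b3 k
     = (c + real m) * ((b1 + real k) * (b2 + real k) * (b3 + real k))
       * wilson_coeff m (c + 1) (b1 + 1) (b2 + 1) (b3 + 1) k"
proof -
  have nz: "b1 \<noteq> 0" "b2 \<noteq> 0" "b3 \<noteq> 0" using add_nat_nonzero[of 0] by simp_all
  have cm: "c \<noteq> 0" "c + real m \<noteq> 0" "pochhammer c m \<noteq> 0" "pochhammer (c + 1) m \<noteq> 0"
    using c by (simp add: pochhammer_rec, simp add: pochhammer_Suc, simp add: pochhammer_Suc,
        simp add: pochhammer_rec)
  have up: "pochhammer (z + 1) j = pochhammer z j * (z + real j) / z" if "z \<noteq> 0" for z :: real and j
    using pochhammer_rec[of z j] pochhammer_Suc[of z j] that by (simp add: field_simps)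
  have p: "pochhammer b1 k \<noteq> 0" "pochhammer b2 k \<noteq> 0" "pochhammer b3 k \<noteq> 0"
    using pochhammer_nonzero[of _ 0 k] b by auto
  note q = add_nat_nonzero[of k]
  show ?thesis
    unfolding wilson_coeff_def up[OF nz(1)] up[OF nz(2)] up[OF nz(3)] up[OF cm(1)]
    using nz cm p q by (simp add: divide_simps)
qed

end

text \<open>Summation of \<open>pochhammer_pair_bi_basis\<close>, with the odd terms shifted by one index so that
  \<open>\<chi>\<^bsub>2k\<^esub>\<close> and \<open>\<chi>\<^bsub>2k+1\<^esub>\<close> are paired.\<close>

lemma sum_pochhammer_pair:
  assumes "u (Suc M) = 0"
  shows "(\<Sum>k\<le>M. u k * (pochhammer (a + x) k * pochhammer (a - x) k))
    = (\<Sum>k\<le>M. u k * poly (bi_basis a (2 * k)) x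
        + real (Suc k) * u (Suc k) * poly (bi_basis a (Suc (2 * k))) x)"
proof -
  have "(\<Sum>k\<le>M. u k * (pochhammer (a + x) k * pochhammer (a - x) k))
      = (\<Sum>k\<le>M. u k * poly (bi_basis a (2 * k)) x
          + real (Suc k) * u (Suc k) * poly (bi_basis a (Suc (2 * k))) x)
        - real (Suc M) * u (Suc M) * poly (bi_basis a (Suc (2 * M))) x" for M
  proof (induction M)
    case 0
    then show ?case by simp
  next
    case (Suc M)
    then show ?case
      unfolding sum.atMost_Suc pochhammer_pair_bi_basis
      by (simp add: algebra_simps del: of_nat_Suc bi_basis.simps mult_Suc_right)
  qed
  with assms show ?thesis by simp
qed

section \<open>The Bannai-Ito polynomials\<close>

definition wilson_W :: "real \<Rightarrow> real \<Rightarrow> real \<Rightarrow> real \<Rightarrow> nat \<Rightarrow> real poly" where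
  "wilson_W r1 r2 \<rho>1 \<rho>2 n =
     (if even n then wilson_U r1 r2 \<rho>1 \<rho>2 (n div 2) \<circ>\<^sub>p [:0, 0, 1:]
      else [:- \<rho>2, 1:] * (wilson_V r1 r2 \<rho>1 \<rho>2 (n div 2) \<circ>\<^sub>p [:0, 0, 1:]))"

lemma poly_wilson_W: "poly (wilson_W r1 r2 \<rho>1 \<rho>2 n) x = bi_W r1 r2 \<rho>1 \<rho>2 (int n) x"
proof -
  have "nat (int n div 2) = n div 2" by (simp add: nat_div_distrib)
  then show ?thesis
    by (simp add: wilson_W_def bi_W_def poly_pcompose power2_eq_square algebra_simps)
qed

lemma monic_wilson_W:
  assumes "bi_g r1 r2 \<rho>1 \<rho>2 \<notin> {- real k | k. k \<ge> 1}"
    and "\<rho>1 + \<rho>2 + 1 \<notin> \<int>\<^sub>\<le>\<^sub>0" "\<rho>2 - r1 + 1/2 \<notin> \<int>\<^sub>\<le>\<^sub>0" "\<rho>2 - r2 + 1/2 \<notin> \<int>\<^sub>\<le>\<^sub>0"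
  shows "degree (wilson_W r1 r2 \<rho>1 \<rho>2 n) = n \<and> lead_coeff (wilson_W r1 r2 \<rho>1 \<rho>2 n) = 1"
proof -
  note w = monic_wilson[OF assms, of "n div 2"]
  let ?s = "[:0, 0, 1 :: real:]"
  have "degree (wilson_U r1 r2 \<rho>1 \<rho>2 (n div 2) \<circ>\<^sub>p ?s) = 2 * (n div 2)"
    "lead_coeff (wilson_U r1 r2 \<rho>1 \<rho>2 (n div 2) \<circ>\<^sub>p ?s) = 1"
    using w by (simp add: degree_pcompose, subst lead_coeff_comp) (use w in simp_all)
  moreover have V: "degree (wilson_V r1 r2 \<rho>1 \<rho>2 (n div 2) \<circ>\<^sub>p ?s) = 2 * (n div 2)"
    "lead_coeff (wilson_V r1 r2 \<rho>1 \<rho>2 (n div 2) \<circ>\<^sub>p ?s) = 1"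
    using w by (simp add: degree_pcompose, subst lead_coeff_comp) (use w in simp_all)
  then have "wilson_V r1 r2 \<rho>1 \<rho>2 (n div 2) \<circ>\<^sub>p ?s \<noteq> 0"
    by (metis coeff_0 zero_neq_one)
  then have "degree ([:- \<rho>2, 1:] * (wilson_V r1 r2 \<rho>1 \<rho>2 (n div 2) \<circ>\<^sub>p ?s)) = Suc (2 * (n div 2))"
    "lead_coeff ([:- \<rho>2, 1:] * (wilson_V r1 r2 \<rho>1 \<rho>2 (n div 2) \<circ>\<^sub>p ?s)) = 1"
    unfolding lead_coeff_mult by (subst degree_mult_eq) (use V in auto)
  ultimately show ?thesis
    by (cases "even n") (simp_all add: wilson_W_def del: mult_pCons_left)
qed

text \<open>The criterion to be verified for both parities: \<open>e k\<close> and \<open>d k\<close> are the coefficients at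
  \<open>\<chi>\<^bsub>2k\<^esub>\<close> and \<open>\<chi>\<^bsub>2k+1\<^esub>\<close>, and the recurrences are those of
  \<open>dunkl_shift_eigenvectorI\<close> with the values of \<open>\<lambda>\<close> and \<open>\<nu>\<close> written out.\<close>

lemma bannai_ito_eq_combination:
  assumes g: "bi_g r1 r2 \<rho>1 \<rho>2 \<notin> {- real k | k. k \<ge> 1}"
    and b: "\<rho>1 + \<rho>2 + 1 \<notin> \<int>\<^sub>\<le>\<^sub>0" "\<rho>2 - r1 + 1/2 \<notin> \<int>\<^sub>\<le>\<^sub>0" "\<rho>2 - r2 + 1/2 \<notin> \<int>\<^sub>\<le>\<^sub>0"
    and W: "\<And>x. bi_W r1 r2 \<rho>1 \<rho>2 (int (Suc n)) x - C * bi_W r1 r2 \<rho>1 \<rho>2 (int n) x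
      = (\<Sum>k\<le>M. e k * poly (bi_basis \<rho>2 (2 * k)) x + d k * poly (bi_basis \<rho>2 (Suc (2 * k))) x)"
    and even_rec: "\<And>k. e k * (dunkl_eigenvalue r1 r2 \<rho>1 \<rho>2 (Suc n) - real k)
      = - ((\<rho>2 - r1 + 1/2 + real k) * (\<rho>2 - r2 + 1/2 + real k)) * d k"
    and odd_rec: "\<And>k. d k * (dunkl_eigenvalue r1 r2 \<rho>1 \<rho>2 (Suc n) + bi_g r1 r2 \<rho>1 \<rho>2 + real (Suc k))
      = real (Suc k) * (\<rho>1 + \<rho>2 + 1 + real k) * e (Suc k)"
    and top: "e (Suc M) = 0"
  shows "poly (bannai_ito r1 r2 \<rho>1 \<rho>2 (Suc n)) x
    = bi_W r1 r2 \<rho>1 \<rho>2 (int (Suc n)) x - C * bi_W r1 r2 \<rho>1 \<rho>2 (int n) x"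
proof -
  define p where "p = wilson_W r1 r2 \<rho>1 \<rho>2 (Suc n) - smult C (wilson_W r1 r2 \<rho>1 \<rho>2 n)"
  define c where "c i = (if even i then e (i div 2) else d (i div 2))" for i
  have pp: "poly p x = bi_W r1 r2 \<rho>1 \<rho>2 (int (Suc n)) x - C * bi_W r1 r2 \<rho>1 \<rho>2 (int n) x" for x
    unfolding p_def poly_diff poly_smult poly_wilson_W ..
  have pc: "p = (\<Sum>i\<le>Suc (2 * M). smult (c i) (bi_basis \<rho>2 i))"
  proof -
    have "poly p x = poly (\<Sum>i\<le>Suc (2 * M). smult (c i) (bi_basis \<rho>2 i)) x" for x
      unfolding pp W sum.in_pairs_0 by (simp add: poly_sum c_def del: bi_basis.simps)
    then show ?thesis by (simp add: poly_eq_poly_eq_iff[symmetric] fun_eq_iff)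
  qed
  have L: "dunkl_shift r1 r2 \<rho>1 \<rho>2 p = smult (dunkl_eigenvalue r1 r2 \<rho>1 \<rho>2 (Suc n)) p"
    unfolding pc
  proof (rule dunkl_shift_eigenvectorI)
    fix i
    show "c i * (dunkl_eigenvalue r1 r2 \<rho>1 \<rho>2 (Suc n) - dunkl_eigenvalue r1 r2 \<rho>1 \<rho>2 i)
      = dunkl_subdiag r1 r2 \<rho>1 \<rho>2 (Suc i) * c (Suc i)"
    proof (cases "even i")
      case True
      then obtain k where i: "i = 2 * k" by (elim evenE)
      have "dunkl_eigenvalue r1 r2 \<rho>1 \<rho>2 i = real k"
        "dunkl_subdiag r1 r2 \<rho>1 \<rho>2 (Suc i) = - ((\<rho>2 - r1 + 1/2 + real k) * (\<rho>2 - r2 + 1/2 + real k))"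
        "c i = e k" "c (Suc i) = d k"
        by (simp_all add: i dunkl_eigenvalue_def dunkl_subdiag_def c_def)
      then show ?thesis using even_rec[of k] by simp
    next
      case False
      then obtain k where i: "i = Suc (2 * k)" by (auto elim: oddE)
      have "dunkl_eigenvalue r1 r2 \<rho>1 \<rho>2 i = - (bi_g r1 r2 \<rho>1 \<rho>2 + real (Suc k))"
        "dunkl_subdiag r1 r2 \<rho>1 \<rho>2 (Suc i) = real (Suc k) * (\<rho>1 + \<rho>2 + 1 + real k)"
        "c i = d k" "c (Suc i) = e (Suc k)"
        by (simp_all add: i dunkl_eigenvalue_def dunkl_subdiag_def c_def bi_g_def add_divide_distrib)
      then show ?thesis using odd_rec[of k] by (simp only: diff_minus_eq_add add.assoc)
    qed
  next
    show "c (Suc (Suc (2 * M))) = 0" using top by (simp add: c_def)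
  qed
  note w = monic_wilson_W[OF g b]
  have lt: "degree (- smult C (wilson_W r1 r2 \<rho>1 \<rho>2 n)) < degree (wilson_W r1 r2 \<rho>1 \<rho>2 (Suc n))"
    using w[of n] w[of "Suc n"] degree_smult_le[of C "wilson_W r1 r2 \<rho>1 \<rho>2 n"] by simp
  have dp: "degree p = Suc n"
    using degree_add_eq_left[OF lt] w[of "Suc n"] unfolding p_def by simp
  have "coeff (wilson_W r1 r2 \<rho>1 \<rho>2 n) (Suc n) = 0"
    using w[of n] by (intro coeff_eq_0) simp
  moreover have "coeff (wilson_W r1 r2 \<rho>1 \<rho>2 (Suc n)) (Suc n) = 1"
    using w[of "Suc n"] by metis
  ultimately have "lead_coeff p = 1" unfolding dp by (simp add: p_def)
  from bannai_ito_eqI[OF g dp this L] pp show ?thesis by simp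
qed

theorem mainTheorem8:
  fixes r1 r2 \<rho>1 \<rho>2 :: real
  assumes "bi_g r1 r2 \<rho>1 \<rho>2 \<notin> {- real k | k. k \<ge> 1}"
    and "\<rho>1 + \<rho>2 + 1 \<notin> \<int>\<^sub>\<le>\<^sub>0"
    and "\<rho>2 - r1 + 1/2 \<notin> \<int>\<^sub>\<le>\<^sub>0"
    and "\<rho>2 - r2 + 1/2 \<notin> \<int>\<^sub>\<le>\<^sub>0"
  shows "\<forall>(n::nat) (x::real).
    poly (bannai_ito r1 r2 \<rho>1 \<rho>2 n) x =
      bi_W r1 r2 \<rho>1 \<rho>2 (int n) x - bi_C r1 r2 \<rho>1 \<rho>2 n * bi_W r1 r2 \<rho>1 \<rho>2 (int n - 1) x"
proof (intro allI)
  fix n :: nat and x :: real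
  define g where "g = bi_g r1 r2 \<rho>1 \<rho>2"
  define b1 b2 b3 where "b1 = \<rho>1 + \<rho>2 + 1" and "b2 = \<rho>2 - r1 + 1/2" and "b3 = \<rho>2 - r2 + 1/2"
  have b: "b1 \<notin> \<int>\<^sub>\<le>\<^sub>0" "b2 \<notin> \<int>\<^sub>\<le>\<^sub>0" "b3 \<notin> \<int>\<^sub>\<le>\<^sub>0" using assms by (simp_all add: b1_def b2_def b3_def)
  have gnz: "g + real (Suc i) \<noteq> 0" for i
  proof
    assume "g + real (Suc i) = 0"
    then have "g = - real (Suc i)" by simp
    with assms(1) show False unfolding g_def by (auto dest: spec[of _ "Suc i"])
  qed
  have poch: "pochhammer (real m + g + real (Suc i)) j \<noteq> 0" for m i j
  proof
    assume "pochhammer (real m + g + real (Suc i)) j = 0"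
    then obtain l where "real m + g + real (Suc i) = - real l" by (auto simp: pochhammer_eq_0_iff)
    with gnz[of "m + i + l"] show False by simp
  qed
  consider "n = 0" | m where "n = Suc (Suc (2 * m))" | m where "n = Suc (2 * m)"
    by (cases n; cases "even n") (auto elim!: evenE oddE)
  then show "poly (bannai_ito r1 r2 \<rho>1 \<rho>2 n) x =
      bi_W r1 r2 \<rho>1 \<rho>2 (int n) x - bi_C r1 r2 \<rho>1 \<rho>2 n * bi_W r1 r2 \<rho>1 \<rho>2 (int n - 1) x"
  proof cases
    case 1
    have W: "degree (wilson_W r1 r2 \<rho>1 \<rho>2 0) = 0" "lead_coeff (wilson_W r1 r2 \<rho>1 \<rho>2 0) = 1"
      using monic_wilson_W[OF assms, of 0] by blast+
    then have "wilson_W r1 r2 \<rho>1 \<rho>2 0 = bi_basis \<rho>2 0"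
      by (auto elim!: degree_eq_zeroE)
    then have "dunkl_shift r1 r2 \<rho>1 \<rho>2 (wilson_W r1 r2 \<rho>1 \<rho>2 0)
        = smult (dunkl_eigenvalue r1 r2 \<rho>1 \<rho>2 0) (wilson_W r1 r2 \<rho>1 \<rho>2 0)"
      by (simp only: dunkl_shift_bi_basis) (simp add: dunkl_subdiag_def)
    from bannai_ito_eqI[OF assms(1) W this] show ?thesis
      using 1 poly_wilson_W[of r1 r2 \<rho>1 \<rho>2 0 x] by (simp add: bi_C_def)
  next
    case (2 m)
    define c where "c = real m + g + 2"
    define u where "u = wilson_coeff (Suc m) c b1 b2 b3"
    define v where "v = wilson_coeff m c (b1 + 1) (b2 + 1) (b3 + 1)"
    define C where "C = bi_C r1 r2 \<rho>1 \<rho>2 n"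
    define d where "d k = real (Suc k) * u (Suc k) - C * v k" for k
    have pc: "pochhammer c j \<noteq> 0" for j using poch[of m 1 j] by (simp add: c_def add_ac)
    have cnz: "c + real k \<noteq> 0" for k using gnz[of "Suc (m + k)"] by (simp add: c_def add_ac)
    have u0: "u (Suc (Suc m)) = 0" "v (Suc m) = 0" by (simp_all add: u_def v_def wilson_coeff_eq_0)
    have C: "C = - real (Suc m) * (real (Suc m) - r1 - r2) / (c + real m)"
    proof -
      have "C = - (4 * (real (Suc m) * (real (Suc m) - r1 - r2))) / (4 * (c + real m))"
        unfolding C_def by (simp add: 2 bi_C_def c_def g_def algebra_simps)
      also have "\<dots> = - (real (Suc m) * (real (Suc m) - r1 - r2)) / (c + real m)"
        by (simp only: minus_mult_right mult_divide_mult_cancel_left_if) simp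
      finally show ?thesis by (simp only: mult_minus_left)
    qed
    \<comment> \<open>The bracket \<open>c + k - (m + 1 - r1 - r2)\<close> collapses to \<open>b1 + k\<close>; this is what fixes
      \<open>C\<close>.\<close>
    have d_eq: "d k * (c + real k) = real (Suc k) * (b1 + real k) * u (Suc k)" for k
    proof -
      have raise: "- real (Suc m) * (c + real k) * v k = real (Suc k) * u (Suc k) * (c + real m)"
        using wilson_coeff_raise_degree[OF b pc, where k = k and m = m, folded u_def v_def]
        by (simp only: mult_ac)
      have "C * v k * (c + real k) = (real (Suc m) - r1 - r2)
          * (- real (Suc m) * (c + real k) * v k) / (c + real m)"
        unfolding C by (simp add: mult_ac del: of_nat_Suc)
      also have "\<dots> = (real (Suc m) - r1 - r2) * (real (Suc k) * u (Suc k))"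
        unfolding raise using cnz[of m] by (simp del: of_nat_Suc)
      finally have "d k * (c + real k)
          = real (Suc k) * u (Suc k) * (c + real k - (real (Suc m) - r1 - r2))"
        unfolding d_def by (simp add: algebra_simps)
      also have "c + real k - (real (Suc m) - r1 - r2) = b1 + real k"
        by (simp add: c_def g_def b1_def bi_g_def)
      finally show ?thesis by (simp add: mult_ac)
    qed
    have "poly (bannai_ito r1 r2 \<rho>1 \<rho>2 (Suc (Suc (2 * m)))) x =
        bi_W r1 r2 \<rho>1 \<rho>2 (int (Suc (Suc (2 * m)))) x - C * bi_W r1 r2 \<rho>1 \<rho>2 (int (Suc (2 * m))) x"
    proof (rule bannai_ito_eq_combination[OF assms])
      fix y
      have "bi_W r1 r2 \<rho>1 \<rho>2 (int (Suc (Suc (2 * m)))) y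
          = (\<Sum>k\<le>Suc m. u k * (pochhammer (\<rho>2 + y) k * pochhammer (\<rho>2 - y) k))"
        using poly_wilson_U_sum[of r1 r2 \<rho>1 \<rho>2 "Suc m" y]
        unfolding poly_wilson_W[symmetric] wilson_W_def
        by (simp add: u_def c_def b1_def b2_def b3_def g_def poly_pcompose power2_eq_square add_ac
            del: sum.atMost_Suc)
      moreover have "bi_W r1 r2 \<rho>1 \<rho>2 (int (Suc (2 * m))) y
          = (\<Sum>k\<le>Suc m. v k * poly (bi_basis \<rho>2 (Suc (2 * k))) y)"
        using poly_wilson_V_sum[of y \<rho>2 r1 r2 \<rho>1 m] u0(2)
        unfolding poly_wilson_W[symmetric] wilson_W_def
        by (simp add: v_def c_def b1_def b2_def b3_def g_def poly_pcompose power2_eq_square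
            del: bi_basis.simps mult_pCons_left)
      ultimately show "bi_W r1 r2 \<rho>1 \<rho>2 (int (Suc (Suc (2 * m)))) y
            - C * bi_W r1 r2 \<rho>1 \<rho>2 (int (Suc (2 * m))) y
          = (\<Sum>k\<le>Suc m. u k * poly (bi_basis \<rho>2 (2 * k)) y + d k * poly (bi_basis \<rho>2 (Suc (2 * k))) y)"
        unfolding sum_pochhammer_pair[of u "Suc m", OF u0(1)] d_def sum_distrib_left
        by (simp add: algebra_simps sum.distrib sum_subtractf sum_distrib_left
            del: sum.atMost_Suc bi_basis.simps of_nat_Suc)
    next
      fix k
      have l: "dunkl_eigenvalue r1 r2 \<rho>1 \<rho>2 (Suc (Suc (2 * m))) = real (Suc m)"
        by (simp add: dunkl_eigenvalue_def)
      have "(c + real k) * (- ((b2 + real k) * (b3 + real k)) * d k)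
          = - (real (Suc k) * ((b1 + real k) * (b2 + real k) * (b3 + real k)) * u (Suc k))"
        using d_eq[of k] by algebra
      also have "\<dots> = (c + real k) * (u k * (real (Suc m) - real k))"
        unfolding u_def wilson_coeff_Suc[OF b] by (simp add: algebra_simps)
      finally show "u k * (dunkl_eigenvalue r1 r2 \<rho>1 \<rho>2 (Suc (Suc (2 * m))) - real k)
          = - ((\<rho>2 - r1 + 1/2 + real k) * (\<rho>2 - r2 + 1/2 + real k)) * d k"
        unfolding l b2_def b3_def using cnz[of k] by (metis mult_left_cancel)
      have "dunkl_eigenvalue r1 r2 \<rho>1 \<rho>2 (Suc (Suc (2 * m))) + bi_g r1 r2 \<rho>1 \<rho>2 + real (Suc k)
          = c + real k" unfolding l by (simp add: c_def g_def)
      then show "d k * (dunkl_eigenvalue r1 r2 \<rho>1 \<rho>2 (Suc (Suc (2 * m))) + bi_g r1 r2 \<rho>1 \<rho>2 + real (Suc k))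
          = real (Suc k) * (\<rho>1 + \<rho>2 + 1 + real k) * u (Suc k)"
        using d_eq[of k] unfolding b1_def by (simp only:)
    qed (use u0 in simp)
    then show ?thesis by (simp add: 2 C_def)
  next
    case (3 m)
    define c where "c = real m + g + 1"
    define u where "u = wilson_coeff m c b1 b2 b3"
    define v where "v = wilson_coeff m (c + 1) (b1 + 1) (b2 + 1) (b3 + 1)"
    define C where "C = bi_C r1 r2 \<rho>1 \<rho>2 n"
    define d where "d k = v k - C * (real (Suc k) * u (Suc k))" for k
    have pc: "pochhammer c j \<noteq> 0" for j using poch[of m 0 j] by (simp add: c_def)
    have cnz: "c + real k \<noteq> 0" for k using gnz[of "m + k"] by (simp add: c_def add_ac)
    have c1: "c + 1 = real m + g + 2" by (simp add: c_def)
    note bnz = add_nat_nonzero[OF b]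
    have u0: "u (Suc m) = 0" by (simp add: u_def wilson_coeff_eq_0)
    have C: "C * (c + real m) = - ((b2 + real m) * (b3 + real m))"
    proof -
      have "C = - (4 * ((b2 + real m) * (b3 + real m))) / (4 * (c + real m))"
        unfolding C_def by (simp add: 3 bi_C_def c_def g_def b2_def b3_def algebra_simps)
      also have "\<dots> = - ((b2 + real m) * (b3 + real m)) / (c + real m)"
        by (simp only: minus_mult_right mult_divide_mult_cancel_left_if) simp
      finally show ?thesis using cnz[of m] by simp
    qed
    have step: "real (Suc k) * ((b1 + real k) * (b2 + real k) * (b3 + real k)) * u (Suc k)
        = (real k - real m) * (c + real k) * u k" for k
      unfolding u_def by (rule wilson_coeff_Suc[OF b])
    \<comment> \<open>The two terms of \<open>d k\<close> contribute \<open>b1 + m\<close> and \<open>k - m\<close>, with sum \<open>b1 + k\<close>; this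
      factor cancels.\<close>
    have d_eq: "(b2 + real k) * (b3 + real k) * d k = - C * u k * (c + real k)" for k
    proof -
      have "(c + real m) * ((b1 + real k) * (b2 + real k) * (b3 + real k) * v k)
          = (c + real m) * (- C * (b1 + real m) * (c + real k) * u k)"
        using wilson_coeff_raise_parameters[OF b pc, where k = k and m = m, folded u_def v_def] C by algebra
      then have "(b1 + real k) * (b2 + real k) * (b3 + real k) * v k
          = - C * (b1 + real m) * (c + real k) * u k"
        using cnz[of m] by (metis mult_left_cancel)
      then have "(b1 + real k) * ((b2 + real k) * (b3 + real k) * d k)
          = (b1 + real k) * (- C * u k * (c + real k))"
        using step[of k] unfolding d_def by algebra
      then show ?thesis using bnz(1)[of k] by (metis mult_left_cancel)
    qed
    have "poly (bannai_ito r1 r2 \<rho>1 \<rho>2 (Suc (2 * m))) x =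
        bi_W r1 r2 \<rho>1 \<rho>2 (int (Suc (2 * m))) x - C * bi_W r1 r2 \<rho>1 \<rho>2 (int (2 * m)) x"
    proof (rule bannai_ito_eq_combination[OF assms, where e = "\<lambda>k. - C * u k"])
      fix y
      have "bi_W r1 r2 \<rho>1 \<rho>2 (int (2 * m)) y
          = (\<Sum>k\<le>m. u k * (pochhammer (\<rho>2 + y) k * pochhammer (\<rho>2 - y) k))"
        using poly_wilson_U_sum[of r1 r2 \<rho>1 \<rho>2 m y]
        unfolding poly_wilson_W[symmetric] wilson_W_def
        by (simp add: u_def c_def b1_def b2_def b3_def g_def poly_pcompose power2_eq_square)
      moreover have "bi_W r1 r2 \<rho>1 \<rho>2 (int (Suc (2 * m))) y
          = (\<Sum>k\<le>m. v k * poly (bi_basis \<rho>2 (Suc (2 * k))) y)"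
        using poly_wilson_V_sum[of y \<rho>2 r1 r2 \<rho>1 m]
        unfolding poly_wilson_W[symmetric] wilson_W_def
        by (simp add: v_def c1 b1_def b2_def b3_def g_def poly_pcompose power2_eq_square
            del: bi_basis.simps mult_pCons_left)
      ultimately show "bi_W r1 r2 \<rho>1 \<rho>2 (int (Suc (2 * m))) y - C * bi_W r1 r2 \<rho>1 \<rho>2 (int (2 * m)) y
          = (\<Sum>k\<le>m. - C * u k * poly (bi_basis \<rho>2 (2 * k)) y + d k * poly (bi_basis \<rho>2 (Suc (2 * k))) y)"
        unfolding sum_pochhammer_pair[of u m, OF u0(1)] d_def sum_distrib_left
        by (simp add: algebra_simps sum.distrib sum_subtractf sum_distrib_left sum_negf
            del: bi_basis.simps of_nat_Suc)
    next
      fix k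
      have l: "dunkl_eigenvalue r1 r2 \<rho>1 \<rho>2 (Suc (2 * m)) = - c"
        by (simp add: dunkl_eigenvalue_def c_def g_def bi_g_def add_divide_distrib)
      show "- C * u k * (dunkl_eigenvalue r1 r2 \<rho>1 \<rho>2 (Suc (2 * m)) - real k)
          = - ((\<rho>2 - r1 + 1/2 + real k) * (\<rho>2 - r2 + 1/2 + real k)) * d k"
        using d_eq[of k] unfolding l b2_def b3_def by algebra
      have "(b2 + real k) * (b3 + real k) * (d k * (real k - real m))
          = (b2 + real k) * (b3 + real k) * (real (Suc k) * (b1 + real k) * (- C * u (Suc k)))"
        using d_eq[of k] step[of k] by algebra
      then have "d k * (real k - real m) = real (Suc k) * (b1 + real k) * (- C * u (Suc k))"
        using bnz(2,3)[of k] by (metis mult_left_cancel mult_eq_0_iff)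
      moreover have "dunkl_eigenvalue r1 r2 \<rho>1 \<rho>2 (Suc (2 * m)) + bi_g r1 r2 \<rho>1 \<rho>2 + real (Suc k)
          = real k - real m" unfolding l by (simp add: c_def g_def)
      ultimately show "d k * (dunkl_eigenvalue r1 r2 \<rho>1 \<rho>2 (Suc (2 * m)) + bi_g r1 r2 \<rho>1 \<rho>2 + real (Suc k))
          = real (Suc k) * (\<rho>1 + \<rho>2 + 1 + real k) * (- C * u (Suc k))"
        unfolding b1_def by (simp only:)
    qed (use u0 in simp)
    then show ?thesis by (simp add: 3 C_def)
  qed
qed

end
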